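(* There is an absolute constant $C$ such that for every prime power $q$, with $n=q^2+q+1$, there is a set of at most $C\,n\log n$ centered rectangles of $S_q$ whose union contains all special entries of $S_q$.
   Context: Let $\mathsf{PG}(2,q)$ be the projective plane over the field with $q$ elements, with point set $\mathcal{P}$ and line set $\mathcal{L}$ (so $|\mathcal{P}|=|\mathcal{L}|=q^2+q+1$). Its incidence graph $\mathcal{I}(q)$ is the bipartite graph on $\mathcal{P}\cup\mathcal{L}$ in which a point is adjacent to a line iff it lies on it; $N(X)$ denotes the set of neighbours of a vertex set $X$. $S_q$ is the edge vs stable set matrix of $\mathcal{I}(q)$: rows indexed by edges, columns by stable sets, entry $1$ at $(e,S)$ iff $e\cap S=\varnothing$ (edges regarded as 2-element vertex sets). A special entry is a $1$-entry of the form $(p\ell, S(X))$ with $p\in\mathcal{P}$, $\ell\in\mathcal{L}$, $p\ell$ an edge, $X$ a non-empty subset of $N(\ell)\setminus\{p\}$, and $S(X)=X\cup(\mathcal{L}\setminus N(X))$. For $\mathcal{P}_R\subseteq\mathcal{P}$, $\mathcal{L}_R\subseteq\mathcal{L}$, the rectangle $R=(\mathcal{P}_R,\mathcal{L}_R)$ is the set of entries $(e,S)$ of $S_q$ where $e$ is an edge between $\mathcal{P}_R$ and $\mathcal{L}_R$ and $S$ is a stable set with $S\subseteq(\mathcal{P}\cup\mathcal{L})\setminus(\mathcal{P}_R\cup\mathcal{L}_R)$. Such $R$ is centered if $|\mathcal{L}_R|\geqslant 2$ and there is a point $c\in\mathcal{P}\setminus\mathcal{P}_R$ incident to every line in $\mathcal{L}_R$.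 *)

theory Defs
  imports
    Complex_Main
    "HOL-Algebra.Weak_Morphisms"
    "HOL-Number_Theory.Prime_Powers"
begin

text \<open>
  The statement quantifies over fields inside the scope of an absolute constant, so the field is a
  HOL-Algebra record rather than a type. It is instantiated with carriers contained in the type
  \<^typ>\<open>nat\<close>, which by the following fact covers all finite fields up to isomorphism.
\<close>

lemma finite_field_nat_copy:
  fixes F :: "('a, 'b) ring_scheme"
  assumes "field F" and "finite (carrier F)"
  shows "\<exists>G :: nat ring. field G \<and> F \<simeq> G"
proof -
  interpret field F by fact
  obtain f :: "'a \<Rightarrow> nat" where f: "inj_on f (carrier F)"
    using finite_imp_inj_to_nat_seg[OF assms(2)] by blast
  have "field (image_ring f F)"
    using inj_imp_image_ring_is_field[OF f] .
  moreover have "F \<simeq> image_ring f F"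
    using inj_imp_image_ring_iso[OF f] unfolding is_ring_iso_def by blast
  ultimately show ?thesis by blast
qed


section \<open>The projective plane over a field\<close>

text \<open>
  Points are the one-dimensional and lines the two-dimensional subspaces of the vector space of
  triples over \<open>F\<close>; a point lies on a line iff it is contained in it. Points and lines thus have
  the same type, but no point is a line.
\<close>

type_synonym 'a vec3 = "'a \<times> 'a \<times> 'a"

definition vecs :: "('a, 'b) ring_scheme \<Rightarrow> 'a vec3 set" where
  "vecs F = carrier F \<times> carrier F \<times> carrier F"

definition vec_zero :: "('a, 'b) ring_scheme \<Rightarrow> 'a vec3" where
  "vec_zero F = (\<zero>\<^bsub>F\<^esub>, \<zero>\<^bsub>F\<^esub>, \<zero>\<^bsub>F\<^esub>)"

fun vec_add :: "('a, 'b) ring_scheme \<Rightarrow> 'a vec3 \<Rightarrow> 'a vec3 \<Rightarrow> 'a vec3" where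
  "vec_add F (x, y, z) (x', y', z') = (x \<oplus>\<^bsub>F\<^esub> x', y \<oplus>\<^bsub>F\<^esub> y', z \<oplus>\<^bsub>F\<^esub> z')"

fun vec_smult :: "('a, 'b) ring_scheme \<Rightarrow> 'a \<Rightarrow> 'a vec3 \<Rightarrow> 'a vec3" where
  "vec_smult F a (x, y, z) = (a \<otimes>\<^bsub>F\<^esub> x, a \<otimes>\<^bsub>F\<^esub> y, a \<otimes>\<^bsub>F\<^esub> z)"

definition lin_indep2 :: "('a, 'b) ring_scheme \<Rightarrow> 'a vec3 \<Rightarrow> 'a vec3 \<Rightarrow> bool" where
  "lin_indep2 F u v \<longleftrightarrow>
    (\<forall>a\<in>carrier F. \<forall>b\<in>carrier F.
      vec_add F (vec_smult F a u) (vec_smult F b v) = vec_zero F \<longrightarrow> a = \<zero>\<^bsub>F\<^esub> \<and> b = \<zero>\<^bsub>F\<^esub>)"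

definition span1 :: "('a, 'b) ring_scheme \<Rightarrow> 'a vec3 \<Rightarrow> 'a vec3 set" where
  "span1 F v = {vec_smult F a v | a. a \<in> carrier F}"

definition span2 :: "('a, 'b) ring_scheme \<Rightarrow> 'a vec3 \<Rightarrow> 'a vec3 \<Rightarrow> 'a vec3 set" where
  "span2 F u v =
    {vec_add F (vec_smult F a u) (vec_smult F b v) | a b. a \<in> carrier F \<and> b \<in> carrier F}"

definition points :: "('a, 'b) ring_scheme \<Rightarrow> 'a vec3 set set" where
  "points F = {span1 F v | v. v \<in> vecs F \<and> v \<noteq> vec_zero F}"

definition lines :: "('a, 'b) ring_scheme \<Rightarrow> 'a vec3 set set" where
  "lines F = {span2 F u v | u v. u \<in> vecs F \<and> v \<in> vecs F \<and> lin_indep2 F u v}"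


section \<open>The incidence graph and its edge vs stable set matrix\<close>

type_synonym 'a vertex = "'a vec3 set"
type_synonym 'a entry = "'a vertex set \<times> 'a vertex set"

definition vertices :: "('a, 'b) ring_scheme \<Rightarrow> 'a vertex set" where
  "vertices F = points F \<union> lines F"

definition edges :: "('a, 'b) ring_scheme \<Rightarrow> 'a vertex set set" where
  "edges F = {{p, l} | p l. p \<in> points F \<and> l \<in> lines F \<and> p \<subseteq> l}"

definition nbrs :: "('a, 'b) ring_scheme \<Rightarrow> 'a vertex set \<Rightarrow> 'a vertex set" where
  "nbrs F X = {v \<in> vertices F. \<exists>x\<in>X. {x, v} \<in> edges F}"

definition stable_sets :: "('a, 'b) ring_scheme \<Rightarrow> 'a vertex set set" where
  "stable_sets F = {S. S \<subseteq> vertices F \<and> (\<forall>e\<in>edges F. \<not> e \<subseteq> S)}"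

definition entries :: "('a, 'b) ring_scheme \<Rightarrow> 'a entry set" where
  "entries F = edges F \<times> stable_sets F"

definition matrix_entry :: "'a entry \<Rightarrow> nat" where
  "matrix_entry = (\<lambda>(e, S). if e \<inter> S = {} then 1 else 0)"

definition stable_of :: "('a, 'b) ring_scheme \<Rightarrow> 'a vertex set \<Rightarrow> 'a vertex set" where
  "stable_of F X = X \<union> (lines F - nbrs F X)"

definition special_entries :: "('a, 'b) ring_scheme \<Rightarrow> 'a entry set" where
  "special_entries F =
    {({p, l}, stable_of F X) | p l X.
      p \<in> points F \<and> l \<in> lines F \<and> {p, l} \<in> edges F \<and> X \<noteq> {} \<and> X \<subseteq> nbrs F {l} - {p}}
    \<inter> {x \<in> entries F. matrix_entry x = 1}"


section \<open>Centered rectangles\<close>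

definition rectangle ::
    "('a, 'b) ring_scheme \<Rightarrow> 'a vertex set \<Rightarrow> 'a vertex set \<Rightarrow> 'a entry set" where
  "rectangle F PR LR =
    {(e, S) \<in> entries F.
      (\<exists>p\<in>PR. \<exists>l\<in>LR. e = {p, l}) \<and> S \<subseteq> vertices F - (PR \<union> LR)}"

definition centered_rectangle :: "('a, 'b) ring_scheme \<Rightarrow> 'a entry set \<Rightarrow> bool" where
  "centered_rectangle F R \<longleftrightarrow>
    (\<exists>PR LR. PR \<subseteq> points F \<and> LR \<subseteq> lines F \<and> R = rectangle F PR LR \<and>
      card LR \<ge> 2 \<and> (\<exists>c \<in> points F - PR. \<forall>l\<in>LR. c \<subseteq> l))"

end

theory Submission
  imports Defs
begin

text \<open>
  Number the points arbitrarily by \<open>0, \<dots>, n - 1\<close>. Given a special entry for \<open>p\<close>, \<open>\<ell>\<close>, \<open>X\<close>, let \<open>c\<close>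
  be a point of \<open>X\<close> whose number is nearest to that of \<open>p\<close>, at distance \<open>d > 0\<close>, and let
  \<open>2\<^sup>i \<le> d < 2\<^sup>i\<^sup>+\<^sup>1\<close>. Every point lying on the same side of \<open>c\<close> as \<open>p\<close> at a distance from \<open>c\<close> in
  \<open>[2\<^sup>i, 2\<^sup>i\<^sup>+\<^sup>1)\<close> is at distance less than \<open>d\<close> from \<open>p\<close>, hence is not in \<open>X\<close>. So the entry lies in the
  rectangle formed by these points and all lines through \<open>c\<close>. There are \<open>n\<close> choices of \<open>c\<close>, two
  sides and \<open>O(log n)\<close> scales \<open>i\<close>.
\<close>

section \<open>Points and lines of the plane over a finite field\<close>

text \<open>If independent \<open>u\<close>, \<open>w\<close> both lay in the span of one vector
  \<open>v\<close>, say \<open>u = s v\<close> and \<open>w = t v\<close>, then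
  \<open>t u - s w = 0\<close> would force \<open>s = 0\<close>, hence \<open>u = 0\<close>, which
  contradicts independence.\<close>

lemma (in field) points_lines_disjoint: "points R \<inter> lines R = {}"
proof -
  have False if v: "v \<in> vecs R" and u: "u \<in> vecs R" and w: "w \<in> vecs R"
    and ind: "lin_indep2 R u w" and eq: "span1 R v = span2 R u w" for u v w
  proof -
    obtain x y z where v': "v = (x, y, z)" "x \<in> carrier R" "y \<in> carrier R" "z \<in> carrier R"
      using v by (auto simp: vecs_def)
    obtain u1 u2 u3 where u': "u = (u1, u2, u3)"
      "u1 \<in> carrier R" "u2 \<in> carrier R" "u3 \<in> carrier R"
      using u by (auto simp: vecs_def)
    obtain w1 w2 w3 where w': "w = (w1, w2, w3)"
      "w1 \<in> carrier R" "w2 \<in> carrier R" "w3 \<in> carrier R"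
      using w by (auto simp: vecs_def)
    have "vec_add R (vec_smult R \<one> u) (vec_smult R \<zero> w) = u"
      "vec_add R (vec_smult R \<zero> u) (vec_smult R \<one> w) = w"
      using u' w' by simp_all
    then have "u \<in> span2 R u w" "w \<in> span2 R u w"
      unfolding span2_def by (metis (mono_tags, lifting) mem_Collect_eq one_closed zero_closed)+
    then obtain s t where st: "s \<in> carrier R" "t \<in> carrier R"
      "u = vec_smult R s v" "w = vec_smult R t v"
      unfolding eq[symmetric] span1_def by auto
    have *: "t \<otimes> (s \<otimes> r) \<oplus> \<ominus> s \<otimes> (t \<otimes> r) = \<zero>" if "r \<in> carrier R" for r
      using st(1,2) that by algebra
    have "vec_add R (vec_smult R t u) (vec_smult R (\<ominus> s) w) = vec_zero R"
      using st v' by (simp add: vec_zero_def *)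
    then have "\<ominus> s = \<zero>"
      using ind st(1,2) unfolding lin_indep2_def by blast
    then have "s = \<zero>"
      using st(1) by (metis minus_minus minus_zero)
    then have "vec_add R (vec_smult R \<one> u) (vec_smult R \<zero> w) = vec_zero R"
      using st v' by (simp add: vec_zero_def)
    then have "\<one> = \<zero>"
      using ind unfolding lin_indep2_def by blast
    then show False by simp
  qed
  then show ?thesis
    unfolding points_def lines_def by blast
qed

lemma (in field) span1_smult:
  assumes "a \<in> carrier R" "a \<noteq> \<zero>" "v \<in> vecs R"
  shows "span1 R (vec_smult R a v) = span1 R v"
proof -
  obtain x y z where v: "v = (x, y, z)" "x \<in> carrier R" "y \<in> carrier R" "z \<in> carrier R"
    using assms(3) by (auto simp: vecs_def)
  have inv: "inv a \<in> carrier R" "inv a \<otimes> a = \<one>"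
    using assms(1,2) field_Units by auto
  have "\<exists>c. vec_smult R b (vec_smult R a v) = vec_smult R c v \<and> c \<in> carrier R"
    if "b \<in> carrier R" for b
    using that assms(1) v by (intro exI[of _ "b \<otimes> a"]) (simp add: m_assoc)
  moreover have "\<exists>c. vec_smult R b v = vec_smult R c (vec_smult R a v) \<and> c \<in> carrier R"
    if b: "b \<in> carrier R" for b
  proof -
    have *: "b \<otimes> inv a \<otimes> (a \<otimes> r) = b \<otimes> r" if "r \<in> carrier R" for r
    proof -
      have "b \<otimes> inv a \<otimes> (a \<otimes> r) = b \<otimes> (inv a \<otimes> a) \<otimes> r"
        using b inv(1) assms(1) that by (simp only: m_assoc m_closed)
      then show ?thesis
        using b inv(2) by simp
    qed
    show ?thesis
      using b inv(1) v * by (intro exI[of _ "b \<otimes> inv a"]) simp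
  qed
  ultimately show ?thesis
    unfolding span1_def by blast
qed

text \<open>Scaling the first nonzero coordinate to \<open>1\<close> leaves representatives of the
  shapes \<open>(1, a, b)\<close>, \<open>(0, 1, a)\<close> and \<open>(0, 0, 1)\<close>, which
  account for the three summands.\<close>

lemma (in field) points_card_le:
  assumes fin: "finite (carrier R)"
  shows "finite (points R)" "card (points R) \<le> (card (carrier R))\<^sup>2 + card (carrier R) + 1"
proof -
  let ?A = "(\<lambda>(a, b). span1 R (\<one>, a, b)) ` (carrier R \<times> carrier R)"
  let ?B = "(\<lambda>a. span1 R (\<zero>, \<one>, a)) ` carrier R"
  let ?C = "{span1 R (\<zero>, \<zero>, \<one>)}"
  have sub: "points R \<subseteq> ?A \<union> ?B \<union> ?C"
  proof
    fix p assume "p \<in> points R"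
    then obtain v where "v \<in> vecs R" "v \<noteq> vec_zero R" "p = span1 R v"
      by (auto simp: points_def)
    then obtain x y z where v: "x \<in> carrier R" "y \<in> carrier R" "z \<in> carrier R"
      "(x, y, z) \<noteq> (\<zero>, \<zero>, \<zero>)" "p = span1 R (x, y, z)"
      by (auto simp: vecs_def vec_zero_def)
    have scale: "p = span1 R (inv a \<otimes> x, inv a \<otimes> y, inv a \<otimes> z)"
      if "a \<in> carrier R" "a \<noteq> \<zero>" for a
    proof -
      have "a \<in> Units R"
        using that field_Units by blast
      then have "inv a \<in> Units R"
        by (rule Units_inv_Units)
      then show ?thesis
        using span1_smult[of "inv a" "(x, y, z)"] v field_Units by (auto simp: vecs_def)
    qed
    have inv: "inv a \<in> carrier R" "inv a \<otimes> a = \<one>" if "a \<in> carrier R" "a \<noteq> \<zero>" for a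
      using that field_Units by auto
    consider "x \<noteq> \<zero>" | "x = \<zero>" "y \<noteq> \<zero>" | "x = \<zero>" "y = \<zero>" "z \<noteq> \<zero>"
      using v by blast
    then show "p \<in> ?A \<union> ?B \<union> ?C"
    proof cases
      case 1
      then have "p = (\<lambda>(a, b). span1 R (\<one>, a, b)) (inv x \<otimes> y, inv x \<otimes> z)"
        using scale[of x] inv[of x] v by simp
      moreover have "(inv x \<otimes> y, inv x \<otimes> z) \<in> carrier R \<times> carrier R"
        using 1 inv v by simp
      ultimately show ?thesis by blast
    next
      case 2
      then have "p = span1 R (\<zero>, \<one>, inv y \<otimes> z)"
        using scale[of y] inv[of y] v by simp
      moreover have "inv y \<otimes> z \<in> carrier R"
        using 2 inv v by simp
      ultimately show ?thesis by blast
    next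
      case 3
      then show ?thesis
        using scale[of z] inv[of z] v by simp
    qed
  qed
  have finABC: "finite (?A \<union> ?B \<union> ?C)"
    using fin by simp
  then show "finite (points R)"
    using sub finite_subset by blast
  have "card ?A \<le> (card (carrier R))\<^sup>2"
    using card_image_le[of "carrier R \<times> carrier R"] fin
    by (simp add: card_cartesian_product power2_eq_square)
  moreover have "card ?B \<le> card (carrier R)"
    using card_image_le fin by blast
  moreover have "card (?A \<union> ?B \<union> ?C) \<le> card ?A + card ?B + card ?C"
    by (meson add_le_mono card_Un_le le_refl order_trans)
  moreover have "card (points R) \<le> card (?A \<union> ?B \<union> ?C)"
    by (rule card_mono[OF finABC sub])
  ultimately show "card (points R) \<le> (card (carrier R))\<^sup>2 + card (carrier R) + 1"
    by simp
qed

text \<open>Supplies the condition of size at least 2 in a centered rectangle. If some coordinate of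
  a spanning vector \<open>v\<close> is nonzero, then \<open>v\<close> and the two standard basis
  vectors of the other coordinates are independent; joining \<open>v\<close> to each of these two
  gives the lines.\<close>

lemma (in field) two_lines_through_point:
  assumes "p \<in> points R"
  obtains l m where "l \<in> lines R" "m \<in> lines R" "p \<subseteq> l" "p \<subseteq> m" "l \<noteq> m"
proof -
  note witness = that
  obtain v where "v \<in> vecs R" "v \<noteq> vec_zero R" "p = span1 R v"
    using assms by (auto simp: points_def)
  then obtain x y z where v: "x \<in> carrier R" "y \<in> carrier R" "z \<in> carrier R"
    "(x, y, z) \<noteq> (\<zero>, \<zero>, \<zero>)" "p = span1 R (x, y, z)"
    by (auto simp: vecs_def vec_zero_def)
  have inc: "p \<subseteq> span2 R (x, y, z) w" if w: "w \<in> vecs R" for w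
  proof -
    have "vec_smult R a (x, y, z) = vec_add R (vec_smult R a (x, y, z)) (vec_smult R \<zero> w)"
      if "a \<in> carrier R" for a
      using that v w by (auto simp: vecs_def)
    then show ?thesis
      unfolding v span1_def span2_def by blast
  qed
  have mem: "w \<in> span2 R u w" if "u \<in> vecs R" "w \<in> vecs R" for u w
  proof -
    have "w = vec_add R (vec_smult R \<zero> u) (vec_smult R \<one> w)"
      using that by (auto simp: vecs_def)
    then show ?thesis
      unfolding span2_def by blast
  qed
  \<comment> \<open>The last hypothesis puts \<open>w'\<close> outside the span of
    \<open>(x, y, z)\<close> and \<open>w\<close>, so the two lines differ.\<close>
  have concl: thesis if w: "w \<in> vecs R" "w' \<in> vecs R" "lin_indep2 R (x, y, z) w"
    "lin_indep2 R (x, y, z) w'"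
    "\<And>a b. a \<in> carrier R \<Longrightarrow> b \<in> carrier R \<Longrightarrow>
      vec_add R (vec_smult R a (x, y, z)) (vec_smult R b w) \<noteq> w'" for w w'
  proof (rule witness)
    have u: "(x, y, z) \<in> vecs R"
      using v by (simp add: vecs_def)
    show "span2 R (x, y, z) w \<in> lines R" "span2 R (x, y, z) w' \<in> lines R"
      using w u unfolding lines_def by blast+
    show "p \<subseteq> span2 R (x, y, z) w" "p \<subseteq> span2 R (x, y, z) w'"
      using w inc by blast+
    show "span2 R (x, y, z) w \<noteq> span2 R (x, y, z) w'"
    proof -
      have "w' \<notin> span2 R (x, y, z) w"
        unfolding span2_def mem_Collect_eq using w(5) by metis
      then show ?thesis
        using mem[OF u w(2)] by blast
    qed
  qed
  consider "x \<noteq> \<zero>" | "y \<noteq> \<zero>" | "z \<noteq> \<zero>"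
    using v by blast
  then show thesis
  proof cases
    case 1
    show thesis
      by (rule concl[of "(\<zero>, \<one>, \<zero>)" "(\<zero>, \<zero>, \<one>)"])
        (use 1 v in \<open>auto simp: vecs_def lin_indep2_def vec_zero_def integral_iff\<close>)
  next
    case 2
    show thesis
      by (rule concl[of "(\<one>, \<zero>, \<zero>)" "(\<zero>, \<zero>, \<one>)"])
        (use 2 v in \<open>auto simp: vecs_def lin_indep2_def vec_zero_def integral_iff\<close>)
  next
    case 3
    show thesis
      by (rule concl[of "(\<one>, \<zero>, \<zero>)" "(\<zero>, \<one>, \<zero>)"])
        (use 3 v in \<open>auto simp: vecs_def lin_indep2_def vec_zero_def integral_iff\<close>)
  qed
qed

lemma finite_lines:
  assumes "finite (carrier F)"
  shows "finite (lines F)"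
proof -
  have "lines F \<subseteq> (\<lambda>(u, v). span2 F u v) ` (vecs F \<times> vecs F)"
    by (auto simp: lines_def)
  then show ?thesis
    using assms by (auto simp: vecs_def intro: finite_subset)
qed

section \<open>Adjacency in the incidence graph\<close>

text \<open>An edge is an unordered pair, so it could a priori be read with the two roles exchanged;
  as no point is a line, knowing that \<open>l\<close> is a line fixes the roles.\<close>

lemma (in field) edge_iff:
  assumes "l \<in> lines R"
  shows "{p, l} \<in> edges R \<longleftrightarrow> p \<in> points R \<and> p \<subseteq> l"
proof
  assume "{p, l} \<in> edges R"
  then obtain p' l' where "{p, l} = {p', l'}" "p' \<in> points R" "l' \<in> lines R" "p' \<subseteq> l'"
    unfolding edges_def mem_Collect_eq by metis
  then show "p \<in> points R \<and> p \<subseteq> l"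
    using assms points_lines_disjoint unfolding doubleton_eq_iff by blast
next
  assume "p \<in> points R \<and> p \<subseteq> l"
  then show "{p, l} \<in> edges R"
    using assms unfolding edges_def by blast
qed

section \<open>Dyadic rectangles around a center\<close>

text \<open>The flag \<open>up\<close> selects the side of \<open>c\<close>; truncated subtraction makes the distance 0, hence less
  than \<open>2\<^sup>i\<close>, for all points on the other side.\<close>

definition dyadic_points ::
    "('a, 'b) ring_scheme \<Rightarrow> ('a vertex \<Rightarrow> nat) \<Rightarrow> 'a vertex \<Rightarrow> nat \<Rightarrow> bool \<Rightarrow> 'a vertex set" where
  "dyadic_points F h c i up =
    {x \<in> points F. (if up then h x - h c else h c - h x) \<in> {2 ^ i..<2 ^ Suc i}}"

definition dyadic_rectangle ::
    "('a, 'b) ring_scheme \<Rightarrow> ('a vertex \<Rightarrow> nat) \<Rightarrow> 'a vertex \<Rightarrow> nat \<Rightarrow> bool \<Rightarrow> 'a entry set" where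
  "dyadic_rectangle F h c i up = rectangle F (dyadic_points F h c i up) {l \<in> lines F. c \<subseteq> l}"

lemma (in field) centered_dyadic_rectangle:
  assumes "finite (carrier R)" and c: "c \<in> points R"
  shows "centered_rectangle R (dyadic_rectangle R h c i up)"
proof -
  obtain l m where lm: "l \<in> lines R" "m \<in> lines R" "c \<subseteq> l" "c \<subseteq> m" "l \<noteq> m"
    using two_lines_through_point[OF c] .
  \<comment> \<open>Finiteness matters here, since \<open>card\<close> of an infinite set is
    0.\<close>
  have "card {l, m} \<le> card {l \<in> lines R. c \<subseteq> l}"
    using finite_lines[OF assms(1)] lm by (intro card_mono) auto
  then have "card {l \<in> lines R. c \<subseteq> l} \<ge> 2"
    using lm(5) by simp
  \<comment> \<open>The distance of \<open>c\<close> from itself is 0, which is below 2^i for every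
    \<open>i\<close>.\<close>
  moreover have "c \<notin> dyadic_points R h c i up"
    by (simp add: dyadic_points_def)
  ultimately show ?thesis
    using c unfolding centered_rectangle_def dyadic_rectangle_def
    by (intro exI[of _ "dyadic_points R h c i up"] exI[of _ "{l \<in> lines R. c \<subseteq> l}"] conjI
        bexI[of _ c]) (simp_all add: dyadic_points_def subset_eq)
qed

lemma dyadic_scale:
  fixes d :: nat
  assumes "0 < d"
  obtains i where "2 ^ i \<le> d" "d < 2 ^ Suc i"
  using ex_power_ivl1[of 2 d] assms by auto

text \<open>Two numbers in [2^i, 2^(i+1)) differ by less than 2^i, and 2^i is at most the distance
  from \<open>c\<close> to \<open>p\<close>. Membership makes both truncated differences positive,
  so \<open>x\<close> and \<open>p\<close> are on the same side of \<open>c\<close>.\<close>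

lemma dyadic_points_near:
  assumes "p \<in> dyadic_points F h c i up" "x \<in> dyadic_points F h c i up"
  shows "\<bar>int (h x) - int (h p)\<bar> < \<bar>int (h c) - int (h p)\<bar>"
  using assms by (auto simp: dyadic_points_def split: if_splits)

lemma (in field) special_entry_in_dyadic_rectangle:
  assumes h: "inj_on h (points R)" "h ` points R \<subseteq> {..<2 ^ k}"
    and special: "s \<in> special_entries R"
  obtains c i up where "c \<in> points R" "i < k" "s \<in> dyadic_rectangle R h c i up"
proof -
  obtain p l X where s: "s = ({p, l}, stable_of R X)" "s \<in> entries R"
    and pl: "p \<in> points R" "l \<in> lines R" "{p, l} \<in> edges R"
    and X: "X \<noteq> {}" "X \<subseteq> nbrs R {l} - {p}"
    using special unfolding special_entries_def by blast
  have Xl: "x \<in> points R" "x \<subseteq> l" "x \<noteq> p" if "x \<in> X" for x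
    using X that edge_iff[OF pl(2)] by (auto simp: nbrs_def insert_commute)
  define dist where "dist x = nat \<bar>int (h x) - int (h p)\<bar>" for x
  obtain c where c: "c \<in> X" and min: "\<And>x. x \<in> X \<Longrightarrow> dist c \<le> dist x"
    using X(1) ex_has_least_nat[of "\<lambda>x. x \<in> X"] by blast
  \<comment> \<open>\<open>X\<close> omits \<open>p\<close>, and the numbering is injective; a
    positive distance is what allows a dyadic scale to be chosen.\<close>
  have "h c \<noteq> h p"
    using h(1) Xl[OF c] pl(1) by (auto dest: inj_onD)
  then have "0 < dist c"
    by (simp add: dist_def)
  then obtain i where i: "2 ^ i \<le> dist c" "dist c < 2 ^ Suc i"
    by (rule dyadic_scale)
  define up where "up \<longleftrightarrow> h c < h p"
  have p_in: "p \<in> dyadic_points R h c i up"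
  proof -
    have "(if up then h p - h c else h c - h p) = dist c"
      by (auto simp: up_def dist_def)
    then show ?thesis
      using i pl(1) by (simp add: dyadic_points_def)
  qed
  \<comment> \<open>A point of \<open>X\<close> in this set would be nearer to \<open>p\<close> than
    \<open>c\<close> is, against the choice of \<open>c\<close>.\<close>
  have avoid: "x \<notin> dyadic_points R h c i up" if "x \<in> X" for x
    using dyadic_points_near[OF p_in] min[OF that] by (force simp: dist_def)
  \<comment> \<open>All numbers are below 2^k, hence so are all distances, and only the scales 0 to
    \<open>k - 1\<close> occur.\<close>
  have "h c < 2 ^ k" "h p < 2 ^ k"
    using h(2) Xl[OF c] pl(1) by auto
  then have "dist c < 2 ^ k"
    unfolding dist_def by linarith
  then have "(2::nat) ^ i < 2 ^ k"
    using i(1) by linarith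
  then have "i < k"
    by simp
  moreover have "stable_of R X \<subseteq> vertices R - (dyadic_points R h c i up \<union> {l \<in> lines R. c \<subseteq> l})"
  proof
    fix y assume y: "y \<in> stable_of R X"
    show "y \<in> vertices R - (dyadic_points R h c i up \<union> {l \<in> lines R. c \<subseteq> l})"
    proof (cases "y \<in> X")
      case True
      then show ?thesis
        using Xl(1)[OF True] avoid[OF True] points_lines_disjoint by (auto simp: vertices_def)
    next
      case False
      then have y': "y \<in> lines R" "y \<notin> nbrs R X"
        using y by (auto simp: stable_of_def)
      \<comment> \<open>A line through \<open>c\<close> would be a neighbour of \<open>X\<close>,
        and such lines are removed from the stable set.\<close>
      then have "\<not> c \<subseteq> y"
        using c Xl[OF c] by (auto simp: nbrs_def vertices_def edge_iff)
      then show ?thesis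
        using y' points_lines_disjoint by (auto simp: vertices_def dyadic_points_def)
    qed
  qed
  \<comment> \<open>The edge belongs to the rectangle because \<open>c\<close>, as a point of
    \<open>X\<close>, lies on \<open>l\<close>.\<close>
  then have "s \<in> dyadic_rectangle R h c i up"
    using s p_in pl(2) Xl[OF c] by (auto simp: dyadic_rectangle_def rectangle_def)
  ultimately show thesis
    using that Xl[OF c] by blast
qed

section \<open>Size of the cover\<close>

lemma (in field) special_entries_cover:
  assumes fin: "finite (carrier R)" and n: "card (points R) \<le> 2 ^ k"
  shows "\<exists>\<R>. finite \<R> \<and> card \<R> \<le> 2 * k * card (points R) \<and>
    (\<forall>T\<in>\<R>. centered_rectangle R T) \<and> special_entries R \<subseteq> \<Union>\<R>"
proof -
  have finp: "finite (points R)"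
    using fin by (rule points_card_le)
  obtain h where h: "bij_betw h (points R) {0..<card (points R)}"
    using ex_bij_betw_finite_nat[OF finp] by blast
  have inj: "inj_on h (points R)" and ran: "h ` points R \<subseteq> {..<2 ^ k}"
    using h n by (auto simp: bij_betw_def)
  let ?I = "points R \<times> {..<k} \<times> (UNIV :: bool set)"
  let ?\<R> = "(\<lambda>(c, i, up). dyadic_rectangle R h c i up) ` ?I"
  have finI: "finite ?I"
    using finp by simp
  \<comment> \<open>Only an inequality, since different triples may yield the same
    rectangle.\<close>
  have "card ?\<R> \<le> card ?I"
    using finI by (rule card_image_le)
  also have "\<dots> = 2 * k * card (points R)"
    by (simp add: card_cartesian_product)
  finally have "card ?\<R> \<le> 2 * k * card (points R)" .
  moreover have "special_entries R \<subseteq> \<Union>?\<R>"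
  proof
    fix s assume "s \<in> special_entries R"
    then obtain c i up where "c \<in> points R" "i < k" "s \<in> dyadic_rectangle R h c i up"
      by (rule special_entry_in_dyadic_rectangle[OF inj ran])
    then show "s \<in> \<Union>?\<R>"
      by force
  qed
  moreover have "\<forall>T\<in>?\<R>. centered_rectangle R T"
    using centered_dyadic_rectangle[OF fin] by auto
  ultimately show ?thesis
    using finI by blast
qed

theorem theorem5:
  shows "\<exists>C :: real. \<forall>q :: nat. primepow q \<longrightarrow>
    (\<forall>F :: nat ring. field F \<and> card (carrier F) = q \<longrightarrow>
      (let n = q\<^sup>2 + q + 1 in
        \<exists>\<R>. finite \<R> \<and> real (card \<R>) \<le> C * real n * ln (real n) \<and>
          (\<forall>R\<in>\<R>. centered_rectangle F R) \<and>
          special_entries F \<subseteq> \<Union>\<R>))"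
proof -
  \<comment> \<open>With \<open>k\<close> the integer part of the binary logarithm of
    \<open>n\<close>, there are \<open>k + 1\<close> scales and two sides; 2(k + 1) \<le> 4k and k
    \<le> ln n / ln 2 give the constant 4 / ln 2.\<close>
  have "\<exists>\<R>. finite \<R> \<and> real (card \<R>) \<le> 4 / ln 2 * real n * ln (real n) \<and>
      (\<forall>T\<in>\<R>. centered_rectangle F T) \<and> special_entries F \<subseteq> \<Union>\<R>"
    if q: "primepow q" and F: "field F" "card (carrier F) = q" and n: "n = q\<^sup>2 + q + 1"
    for q n and F :: "nat ring"
  proof -
    interpret field F by fact
    have "q > 0"
      using primepow_gt_0_nat[OF q] .
    then have fin: "finite (carrier F)"
      using F(2) card_ge_0_finite by blast
    have card: "card (points F) \<le> n"
      using points_card_le(2)[OF fin] F(2) n by simp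
    have "n \<ge> 2"
      using \<open>q > 0\<close> n by simp
    obtain k where k: "2 ^ k \<le> n" "n < 2 ^ Suc k"
      using dyadic_scale[of n] \<open>n \<ge> 2\<close> by auto
    \<comment> \<open>This is what lets \<open>k + 1\<close> be bounded by
      \<open>2 k\<close>.\<close>
    have "k \<noteq> 0"
      using k \<open>n \<ge> 2\<close> by (cases k) auto
    have "real k * ln 2 = ln (2 ^ k)"
      by (simp add: ln_realpow)
    also have "\<dots> \<le> ln (real n)"
      using k(1) by (subst ln_le_cancel_iff) (use \<open>n \<ge> 2\<close> in auto)
    finally have "real k \<le> ln (real n) / ln 2"
      by (simp add: field_simps)
    then have logn: "real (2 * Suc k) \<le> 4 * (ln (real n) / ln 2)"
      using \<open>k \<noteq> 0\<close> by simp
    \<comment> \<open>The exponent is \<open>Suc k\<close> rather than \<open>k\<close>, because 2^k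
      may be smaller than the number of points.\<close>
    obtain \<R> where R: "finite \<R>" "card \<R> \<le> 2 * Suc k * card (points F)"
      "\<forall>T\<in>\<R>. centered_rectangle F T" "special_entries F \<subseteq> \<Union>\<R>"
      using special_entries_cover[OF fin, of "Suc k"] card k(2) by auto
    have "card \<R> \<le> 2 * Suc k * n"
      using R(2) mult_le_mono2[OF card] order_trans by blast
    then have "real (card \<R>) \<le> real (2 * Suc k) * real n"
      by (metis of_nat_le_iff of_nat_mult)
    also have "\<dots> \<le> 4 * (ln (real n) / ln 2) * real n"
      using logn by (rule mult_right_mono) simp
    also have "\<dots> = 4 / ln 2 * real n * ln (real n)"
      by simp
    finally show ?thesis
      using R by blast
  qed
  then show ?thesis
    unfolding Let_def by blast
qed

end
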